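(* Let $d\ge 1$ and $n$ be such that $2^d+d=n/2$. Then there is an exact affine OBDD with $2^{d+1}$ classical states and $2^d+1$ affine states that computes $\mathtt{SSA}_n$.
   Context: Shuffled Storage Access function $\mathtt{SSA}_n:\{0,1\}^n\to\{0,1\}$ ($n$ even, $2^d+d=n/2$): for input $x$, let $I_0=(2i_1<\dots<2i_m)$ be the sorted list of even indices $2i$ with $x_{2i-1}=0$ and $I_1=(2j_1<\dots<2j_k)$ the sorted list of even indices $2i$ with $x_{2i-1}=1$. Let $\mathtt{ShiftX}((a_1,\dots,a_t),b)=(a_2,\dots,a_t,a_1\oplus b)$. Start with $\alpha=0^{2^d}$ and for $r=1,\dots,m$ set $\alpha:=\mathtt{ShiftX}(\alpha,x_{2i_r})$; start with $\beta=0^d$ and for $r=1,\dots,k$ set $\beta:=\mathtt{ShiftX}(\beta,x_{2j_r})$. Then $\mathtt{SSA}_n(x)$ is the bit of $\alpha$ at the address encoded in binary by $\beta$. An affine OBDD (AfOBDD) is a tuple $(S,E,\delta,T,s_I,v_0,S_a,E_a,\pi)$: $S$ is a finite set of classical states with initial state $s_I$ and accepting set $S_a$; $E=\{e_1,\dots,e_{m_2}\}$ is a set of affine states with accepting set $E_a$; $v_0\in\mathbb{R}^{m_2}$ is an initial affine state (a real vector with entries summing to $1$); $\pi$ is a permutation of $\{1,\dots,n\}$; for each step $i$, $\delta_i:S\times\{0,1\}\to S$; and for each step $i$, classical state $s$ and bit $b$, $T_i^{s,b}$ is a real $m_2\times m_2$ matrix each of whose columns sums to $1$. On input $x$ it starts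 in $(s_I,v_0)$; at step $j$, from $(s,v_{j-1})$ it sets $v_j=T_j^{s,x_{\pi(j)}}v_{j-1}$ and then the classical state to $\delta_j(s,x_{\pi(j)})$. If the final classical state is not in $S_a$ it rejects; otherwise it accepts with probability $\sum_{e_i\in E_a}|v_f[i]|/\|v_f\|_1$. It computes $f$ exactly if $1$-inputs are accepted with probability $1$ and $0$-inputs with probability $0$. *)

theory Defs
  imports "Jordan_Normal_Form.Matrix" "HOL-Combinatorics.Permutations"
begin

text \<open>
  An input in \<open>{0,1}^n\<close> is a function \<open>x :: nat \<Rightarrow> bool\<close>, of which only the values
  \<open>x 1, \<dots>, x n\<close> are read. Exclusive or of bits is \<open>\<noteq>\<close>.
\<close>

text \<open>The equation for the empty list only makes the function total.\<close>

fun ShiftX :: "bool list \<Rightarrow> bool \<Rightarrow> bool list" where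
  "ShiftX [] b = []"
| "ShiftX (a # as) b = as @ [a \<noteq> b]"

definition even_indices :: "nat \<Rightarrow> (nat \<Rightarrow> bool) \<Rightarrow> bool \<Rightarrow> nat list" where
  "even_indices n x c = filter (\<lambda>k. even k \<and> x (k - 1) = c) [1..<n + 1]"

definition SSA_storage :: "nat \<Rightarrow> nat \<Rightarrow> (nat \<Rightarrow> bool) \<Rightarrow> bool list" where
  "SSA_storage d n x = foldl ShiftX (replicate (2 ^ d) False) (map x (even_indices n x False))"

definition SSA_address :: "nat \<Rightarrow> nat \<Rightarrow> (nat \<Rightarrow> bool) \<Rightarrow> bool list" where
  "SSA_address d n x = foldl ShiftX (replicate d False) (map x (even_indices n x True))"

text \<open>
  The first bit of the address is the most significant one (\<open>horner_sum\<close> expects the least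
  significant bit first); addresses \<open>0, \<dots>, 2^d - 1\<close> select the storage bits from left to right.
\<close>

definition SSA :: "nat \<Rightarrow> nat \<Rightarrow> (nat \<Rightarrow> bool) \<Rightarrow> bool" where
  "SSA d n x = SSA_storage d n x ! horner_sum of_bool 2 (rev (SSA_address d n x))"

text \<open>
  The affine states \<open>e\<^sub>1, \<dots>, e\<^sub>m\<close> are represented by the vector indices \<open>0, \<dots>, m - 1\<close>,
  where \<open>m\<close> is \<open>num_affine\<close>. Steps and input variables are numbered from 1.
\<close>

record 's afobdd =
  cstates :: "'s set"
  num_affine :: nat
  cdelta :: "nat \<Rightarrow> 's \<Rightarrow> bool \<Rightarrow> 's"
  atrans :: "nat \<Rightarrow> 's \<Rightarrow> bool \<Rightarrow> real mat"
  cinit :: 's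
  ainit :: "real vec"
  cacc :: "'s set"
  aacc :: "nat set"
  var_order :: "nat \<Rightarrow> nat"

definition is_afobdd :: "nat \<Rightarrow> 's afobdd \<Rightarrow> bool" where
  "is_afobdd n M \<longleftrightarrow>
     finite (cstates M) \<and>
     cinit M \<in> cstates M \<and>
     cacc M \<subseteq> cstates M \<and>
     aacc M \<subseteq> {..<num_affine M} \<and>
     ainit M \<in> carrier_vec (num_affine M) \<and>
     (\<Sum>i<num_affine M. ainit M $ i) = 1 \<and>
     var_order M permutes {1..n} \<and>
     (\<forall>j\<in>{1..n}. \<forall>s\<in>cstates M. \<forall>b.
        cdelta M j s b \<in> cstates M \<and>
        atrans M j s b \<in> carrier_mat (num_affine M) (num_affine M) \<and>
        (\<forall>l<num_affine M. (\<Sum>i<num_affine M. atrans M j s b $$ (i, l)) = 1))"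

fun config :: "'s afobdd \<Rightarrow> (nat \<Rightarrow> bool) \<Rightarrow> nat \<Rightarrow> 's \<times> real vec" where
  "config M x 0 = (cinit M, ainit M)"
| "config M x (Suc j) =
     (let (s, v) = config M x j;
          b = x (var_order M (Suc j))
      in (cdelta M (Suc j) s b, atrans M (Suc j) s b *\<^sub>v v))"

definition accept_prob :: "nat \<Rightarrow> 's afobdd \<Rightarrow> (nat \<Rightarrow> bool) \<Rightarrow> real" where
  "accept_prob n M x =
     (let (s, v) = config M x n
      in if s \<in> cacc M
         then (\<Sum>i\<in>aacc M. \<bar>v $ i\<bar>) / (\<Sum>i<num_affine M. \<bar>v $ i\<bar>)
         else 0)"

definition computes_exactly :: "nat \<Rightarrow> 's afobdd \<Rightarrow> ((nat \<Rightarrow> bool) \<Rightarrow> bool) \<Rightarrow> bool" where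
  "computes_exactly n M f \<longleftrightarrow>
     (\<forall>x. (f x \<longrightarrow> accept_prob n M x = 1) \<and> (\<not> f x \<longrightarrow> accept_prob n M x = 0))"

end

theory Submission imports Defs begin

text \<open>
  The classical state stores the address and the last control bit. The affine state stores the
  \<open>N = 2^d\<close> storage bits in its first \<open>N\<close> entries; the last entry is whatever makes the entries sum
  to 1. Since the entries sum to 1, negating a bit, \<open>a \<mapsto> 1 - a\<close>, is a linear functional of the
  affine state, namely the sum of all other entries, so \<open>ShiftX\<close> with a known bit acts by a matrix
  whose column sums are made 1 by the last row. At the last step the address is known classically,
  so the transition matrix may also move the addressed bit \<open>a\<close> to the first entry and clear the
  others. The final affine state is then \<open>(a, 0, \<dots>, 0, 1 - a)\<close>, which is accepted with
  probability \<open>a\<close>.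
\<close>

section \<open>Relabelling classical states\<close>

lemma config_in_cstates:
  assumes "is_afobdd n M" "j \<le> n"
  shows "fst (config M x j) \<in> cstates M"
  using assms(2)
proof (induction j)
  case 0
  then show ?case using assms(1) by (simp add: is_afobdd_def)
next
  case (Suc j)
  then show ?case using assms(1)
    by (auto simp: is_afobdd_def Let_def split: prod.splits)
qed

text \<open>The natural classical states are pairs of an address and a bit, whereas the theorem asks
  for states of type \<open>nat\<close>. Renaming along a bijection preserves runs and acceptance;
  the inverse \<open>g\<close> is only meaningful on \<open>cstates M\<close>, so runs must be known
  to stay there, which holds up to step \<open>n\<close>.\<close>

lemma afobdd_relabel:
  fixes M :: "'s afobdd" and h :: "'t \<Rightarrow> 's"
  assumes M: "is_afobdd n M" and h: "bij_betw h S (cstates M)"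
  shows "\<exists>M' :: 't afobdd. is_afobdd n M' \<and> cstates M' = S \<and> num_affine M' = num_affine M \<and>
           accept_prob n M' = accept_prob n M"
proof -
  define g where "g = inv_into S h"
  have hS: "h s \<in> cstates M" if "s \<in> S" for s
    using h that by (auto dest: bij_betwE)
  have gS: "g s \<in> S" and hg: "h (g s) = s" if "s \<in> cstates M" for s
    using h that unfolding g_def
    by (auto simp: bij_betw_def inv_into_into f_inv_into_f)
  have gh: "g (h s) = s" if "s \<in> S" for s
    using h that unfolding g_def by (auto simp: bij_betw_def)
  define M' where "M' = \<lparr>cstates = S, num_affine = num_affine M,
     cdelta = (\<lambda>j s b. g (cdelta M j (h s) b)), atrans = (\<lambda>j s b. atrans M j (h s) b),
     cinit = g (cinit M), ainit = ainit M, cacc = g ` cacc M, aacc = aacc M,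
     var_order = var_order M\<rparr>"
  have "finite S"
    using M h bij_betw_finite by (fastforce simp: is_afobdd_def)
  then have afobdd: "is_afobdd n M'"
    using M hS gS unfolding is_afobdd_def M'_def by auto
  have conf: "config M' x j = map_prod g id (config M x j)" if "j \<le> n" for x j
    using that
  proof (induction j)
    case 0
    show ?case by (simp add: M'_def)
  next
    case (Suc j)
    obtain s v where sv: "config M x j = (s, v)" by fastforce
    have "s \<in> cstates M"
      using config_in_cstates[OF M, of j x] Suc.prems sv by simp
    then show ?case
      using Suc sv hg by (simp add: Let_def) (simp add: M'_def)
  qed
  have "accept_prob n M' x = accept_prob n M x" for x
  proof -
    obtain s v where sv: "config M x n = (s, v)" by fastforce
    have "s \<in> cstates M"
      using config_in_cstates[OF M, of n x] sv by simp
    moreover have "cacc M \<subseteq> cstates M"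
      using M by (simp add: is_afobdd_def)
    \<comment> \<open>Acceptance is preserved because \<open>g\<close> is injective on
      \<open>cstates M\<close>, with left inverse \<open>h\<close>.\<close>
    ultimately have "g s \<in> g ` cacc M \<longleftrightarrow> s \<in> cacc M"
      by (metis hg image_iff subsetD)
    then show ?thesis
      using conf[of n x] sv by (simp add: accept_prob_def M'_def)
  qed
  with afobdd show ?thesis
    by (intro exI[of _ M']) (auto simp: M'_def)
qed

section \<open>Affine matrices and bit vectors\<close>

definition affine_mat :: "nat \<Rightarrow> real mat \<Rightarrow> bool" where
  "affine_mat m A \<longleftrightarrow> A \<in> carrier_mat m m \<and> (\<forall>l<m. (\<Sum>i<m. A $$ (i, l)) = 1)"

lemma affine_mat_one: "affine_mat m (1\<^sub>m m)"
proof -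
  have "(\<Sum>i<m. 1\<^sub>m m $$ (i, l)) = (1::real)" if "l < m" for l
  proof -
    have "(\<Sum>i<m. 1\<^sub>m m $$ (i, l)) = (\<Sum>i<m. if i = l then 1 else (0::real))"
      using that by (intro sum.cong) auto
    then show ?thesis using that by simp
  qed
  then show ?thesis by (simp add: affine_mat_def)
qed

lemma affine_mat_mult:
  assumes "affine_mat m A" "affine_mat m B"
  shows "affine_mat m (A * B)"
proof -
  have A: "A \<in> carrier_mat m m" and B: "B \<in> carrier_mat m m"
    using assms by (auto simp: affine_mat_def)
  have "(\<Sum>i<m. (A * B) $$ (i, l)) = 1" if l: "l < m" for l
  proof -
    have "(\<Sum>i<m. (A * B) $$ (i, l)) = (\<Sum>i<m. \<Sum>k<m. A $$ (i, k) * B $$ (k, l))"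
      using A B l by (intro sum.cong) (auto simp: scalar_prod_def atLeast0LessThan)
    also have "\<dots> = (\<Sum>k<m. (\<Sum>i<m. A $$ (i, k)) * B $$ (k, l))"
      by (subst sum.swap) (simp add: sum_distrib_right)
    also have "\<dots> = (\<Sum>k<m. B $$ (k, l))"
      using assms(1) by (intro sum.cong) (auto simp: affine_mat_def)
    also have "\<dots> = 1"
      using assms(2) l by (simp add: affine_mat_def)
    finally show ?thesis .
  qed
  then show ?thesis using A B by (simp add: affine_mat_def)
qed

section \<open>Bit lists as affine states\<close>

definition complete_mat :: "nat \<Rightarrow> (nat \<Rightarrow> nat \<Rightarrow> real) \<Rightarrow> real mat" where
  "complete_mat N R =
     mat (Suc N) (Suc N) (\<lambda>(i, j). if i < N then R i j else 1 - (\<Sum>k<N. R k j))"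

lemma affine_mat_complete_mat: "affine_mat (Suc N) (complete_mat N R)"
  by (simp add: affine_mat_def complete_mat_def)

text \<open>The last entry is 1 minus the number of ones, hence negative as soon as two bits are
  set: the vector is affine but in general not stochastic.\<close>

definition bits_vec :: "bool list \<Rightarrow> real vec" where
  "bits_vec bs = vec (Suc (length bs))
     (\<lambda>i. if i < length bs then of_bool (bs ! i) else 1 - (\<Sum>k<length bs. of_bool (bs ! k)))"

lemma dim_bits_vec [simp]: "dim_vec (bits_vec bs) = Suc (length bs)"
  by (simp add: bits_vec_def)

lemma bits_vec_carrier: "length bs = N \<Longrightarrow> bits_vec bs \<in> carrier_vec (Suc N)"
  by (rule carrier_vecI) simp

lemma bits_vec_nth: "i < length bs \<Longrightarrow> bits_vec bs $ i = of_bool (bs ! i)"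
  by (simp add: bits_vec_def)

lemma sum_bits_vec: "(\<Sum>i<Suc (length bs). bits_vec bs $ i) = 1"
  by (simp add: bits_vec_def)

text \<open>The entries of \<open>bits_vec cs\<close> sum to 1, so the first \<open>N\<close>
  determine the last one, and only the rows given by \<open>R\<close> need checking.\<close>

lemma complete_mat_mult_bits_vec:
  assumes "length bs = N" "length cs = N"
    and R: "\<And>i. i < N \<Longrightarrow> (\<Sum>j<Suc N. R i j * bits_vec bs $ j) = of_bool (cs ! i)"
  shows "complete_mat N R *\<^sub>v bits_vec bs = bits_vec cs"
proof (rule eq_vecI)
  fix i assume "i < dim_vec (bits_vec cs)"
  then have i: "i < Suc N" using assms by simp
  have mv: "(complete_mat N R *\<^sub>v bits_vec bs) $ i =
      (\<Sum>j<Suc N. (if i < N then R i j else 1 - (\<Sum>k<N. R k j)) * bits_vec bs $ j)"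
    using i assms(1)
    by (simp add: complete_mat_def scalar_prod_def atLeast0LessThan del: sum.lessThan_Suc)
  show "(complete_mat N R *\<^sub>v bits_vec bs) $ i = bits_vec cs $ i"
  proof (cases "i < N")
    case True
    then show ?thesis using mv R assms(2) by (simp add: bits_vec_nth)
  next
    case False
    \<comment> \<open>The last row is the all-ones row minus the other rows, so it yields the total
      1 of the input entries minus the first \<open>N\<close> output entries.\<close>
    have "(\<Sum>j<Suc N. (1 - (\<Sum>k<N. R k j)) * bits_vec bs $ j) =
        (\<Sum>j<Suc N. bits_vec bs $ j) - (\<Sum>k<N. \<Sum>j<Suc N. R k j * bits_vec bs $ j)"
      by (subst sum.swap)
        (simp add: left_diff_distrib sum_subtractf sum_distrib_right del: sum.lessThan_Suc)
    also have "\<dots> = 1 - (\<Sum>k<N. of_bool (cs ! k))"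
      using sum_bits_vec[of bs] assms(1) R by (simp del: sum.lessThan_Suc)
    finally show ?thesis
      using False mv i assms(2) by (simp add: bits_vec_def[of cs] del: sum.lessThan_Suc)
  qed
qed (use assms in \<open>simp add: complete_mat_def\<close>)

text \<open>For \<open>b\<close> false the coefficients form a unit vector. For \<open>b\<close>
  true they form the all-ones vector minus that unit vector, which gives 1 minus the bit because the
  entries sum to 1.\<close>

lemma xor_functional:
  assumes k: "k < length bs"
  shows "(\<Sum>j<Suc (length bs). of_bool ((j = k) \<noteq> b) * bits_vec bs $ j) = of_bool ((bs ! k) \<noteq> b)"
proof -
  have single: "(\<Sum>j<Suc (length bs). of_bool (j = k) * bits_vec bs $ j) = of_bool (bs ! k)"
  proof -
    have "(\<Sum>j<Suc (length bs). of_bool (j = k) * bits_vec bs $ j) =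
        (\<Sum>j<Suc (length bs). if j = k then bits_vec bs $ k else 0)"
      by (intro sum.cong) auto
    also have "\<dots> = bits_vec bs $ k"
      using k by (subst sum.delta) auto
    finally show ?thesis using k by (simp add: bits_vec_nth)
  qed
  show ?thesis
  proof (cases b)
    case True
    have "(\<Sum>j<Suc (length bs). of_bool (j \<noteq> k) * bits_vec bs $ j) =
        (\<Sum>j<Suc (length bs). bits_vec bs $ j) - (\<Sum>j<Suc (length bs). of_bool (j = k) * bits_vec bs $ j)"
      unfolding sum_subtractf[symmetric] by (intro sum.cong) auto
    then show ?thesis
      unfolding sum_bits_vec single using True by auto
  next
    case False
    then show ?thesis using single by simp
  qed
qed

section \<open>Shifting and selecting by matrices\<close>

definition shift_mat :: "nat \<Rightarrow> bool \<Rightarrow> real mat" where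
  "shift_mat N b =
     complete_mat N (\<lambda>i j. of_bool ((j = Suc i mod N) \<noteq> (b \<and> Suc i = N)))"

definition select_mat :: "nat \<Rightarrow> nat \<Rightarrow> real mat" where
  "select_mat N k = complete_mat N (\<lambda>i j. of_bool (i = 0 \<and> j = k))"

lemma length_ShiftX [simp]: "length (ShiftX bs b) = length bs"
  by (cases bs) auto

text \<open>Cyclic indexing lets one formula, matching the rows of \<open>shift_mat\<close>, cover
  the bits that move left and the first bit, which wraps to the end and alone may be
  flipped.\<close>

lemma ShiftX_nth:
  assumes "i < length bs"
  shows "ShiftX bs b ! i = (bs ! (Suc i mod length bs) \<noteq> (b \<and> Suc i = length bs))"
proof (cases bs)
  case (Cons a as)
  show ?thesis
  proof (cases "i < length as")
    case True
    then have "Suc i mod Suc (length as) = Suc i" by simp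
    then show ?thesis using Cons True by (simp add: nth_append)
  next
    case False
    then show ?thesis using Cons assms by (simp add: nth_append less_Suc_eq)
  qed
qed (use assms in simp)

lemma shift_mat_mult:
  assumes "length bs = N"
  shows "shift_mat N b *\<^sub>v bits_vec bs = bits_vec (ShiftX bs b)"
  unfolding shift_mat_def
proof (rule complete_mat_mult_bits_vec)
  fix i assume i: "i < N"
  then have "Suc i mod N < length bs" using assms by simp
  from xor_functional[OF this, of "b \<and> Suc i = N"] i
  show "(\<Sum>j<Suc N. of_bool ((j = Suc i mod N) \<noteq> (b \<and> Suc i = N)) * bits_vec bs $ j) =
      of_bool (ShiftX bs b ! i)"
    using assms by (simp only: ShiftX_nth)
qed (use assms in simp_all)

lemma select_mat_mult:
  assumes "length bs = N" "k < N"
  shows "select_mat N k *\<^sub>v bits_vec bs = bits_vec (bs ! k # replicate (N - 1) False)"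
  unfolding select_mat_def
proof (rule complete_mat_mult_bits_vec)
  fix i assume "i < N"
  then show "(\<Sum>j<Suc N. of_bool (i = 0 \<and> j = k) * bits_vec bs $ j) =
      of_bool ((bs ! k # replicate (N - 1) False) ! i)"
    using xor_functional[of k bs False] assms
    by (cases i) (simp_all del: sum.lessThan_Suc)
qed (use assms in simp_all)

text \<open>The vector is (a, 0, ..., 0, 1 - a) with a in {0, 1}, so no entry is negative. Without
  clearing the other bits the norm could exceed 1 and exactness would be lost.\<close>

lemma sum_abs_selected:
  "(\<Sum>i<Suc (Suc m). \<bar>bits_vec (a # replicate m False) $ i\<bar>) = 1"
proof -
  have "(\<Sum>i<Suc m. of_bool ((a # replicate m False) ! i)) = (of_bool a :: real)"
    unfolding sum.lessThan_Suc_shift by simp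
  then show ?thesis
    by (simp add: bits_vec_def del: sum.lessThan_Suc)
      (simp add: sum.lessThan_Suc[of _ "Suc m"] del: sum.lessThan_Suc)
qed

section \<open>Shuffled storage access\<close>

definition address :: "bool list \<Rightarrow> nat" where
  "address bs = horner_sum of_bool 2 (rev bs)"

lemma address_less: "address bs < 2 ^ length bs"
  unfolding address_def using horner_sum_of_bool_2_less[of "rev bs"] by simp

text \<open>The length argument doubles as the length of the prefix read: values at
  \<open>2 * i\<close> are those after \<open>i\<close> pairs of a control bit and a data bit. The
  recursions below thus follow the run pair by pair.\<close>

lemma even_indices_Suc:
  "even_indices (2 * Suc i) x c =
     even_indices (2 * i) x c @ (if x (Suc (2 * i)) = c then [Suc (Suc (2 * i))] else [])"
  by (simp add: even_indices_def)

lemma SSA_storage_0: "SSA_storage d 0 x = replicate (2 ^ d) False"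
  by (simp add: SSA_storage_def even_indices_def)

lemma SSA_address_0: "SSA_address d 0 x = replicate d False"
  by (simp add: SSA_address_def even_indices_def)

lemma SSA_storage_Suc:
  "SSA_storage d (2 * Suc i) x =
     (if x (Suc (2 * i)) then SSA_storage d (2 * i) x
      else ShiftX (SSA_storage d (2 * i) x) (x (Suc (Suc (2 * i)))))"
  unfolding SSA_storage_def even_indices_Suc by simp

lemma SSA_address_Suc:
  "SSA_address d (2 * Suc i) x =
     (if x (Suc (2 * i)) then ShiftX (SSA_address d (2 * i) x) (x (Suc (Suc (2 * i))))
      else SSA_address d (2 * i) x)"
  unfolding SSA_address_def even_indices_Suc by simp

lemma length_SSA_storage: "length (SSA_storage d (2 * i) x) = 2 ^ d"
  by (induction i) (simp_all add: SSA_storage_0 SSA_storage_Suc del: mult_Suc_right)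

lemma length_SSA_address: "length (SSA_address d (2 * i) x) = d"
  by (induction i) (simp_all add: SSA_address_0 SSA_address_Suc del: mult_Suc_right)

section \<open>The automaton\<close>

definition storage_mat :: "nat \<Rightarrow> bool \<Rightarrow> bool \<Rightarrow> real mat" where
  "storage_mat N c b = (if c then 1\<^sub>m (Suc N) else shift_mat N b)"

definition update_address :: "bool list \<times> bool \<Rightarrow> bool \<Rightarrow> bool list" where
  "update_address s b = (if snd s then ShiftX (fst s) b else fst s)"

text \<open>Odd steps only remember the control bit; even steps act on the data bit. The matrix
  depends on the classical state before its update, so at \<open>j = n\<close> the new address is
  computed inside \<open>atrans\<close>. Every classical state accepts, since the decision lies in
  affine entry 0.\<close>

definition SSA_afobdd :: "nat \<Rightarrow> nat \<Rightarrow> (bool list \<times> bool) afobdd" where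
  "SSA_afobdd d n = \<lparr>
     cstates = {bs. length bs = d} \<times> UNIV,
     num_affine = Suc (2 ^ d),
     cdelta = (\<lambda>j s b. if odd j then (fst s, b) else (update_address s b, False)),
     atrans = (\<lambda>j s b.
       if odd j then 1\<^sub>m (Suc (2 ^ d))
       else if j = n then select_mat (2 ^ d) (address (update_address s b)) * storage_mat (2 ^ d) (snd s) b
       else storage_mat (2 ^ d) (snd s) b),
     cinit = (replicate d False, False),
     ainit = bits_vec (replicate (2 ^ d) False),
     cacc = {bs. length bs = d} \<times> UNIV,
     aacc = {0},
     var_order = id\<rparr>"

lemma affine_mat_storage_mat: "affine_mat (Suc N) (storage_mat N c b)"
  by (simp add: storage_mat_def shift_mat_def affine_mat_one affine_mat_complete_mat)

lemma card_bool_lists: "card {bs :: bool list. length bs = d} = 2 ^ d"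
  using card_lists_length_eq[of "UNIV :: bool set" d] by simp

lemma finite_bool_lists: "finite {bs :: bool list. length bs = d}"
  using finite_lists_length_eq[of "UNIV :: bool set" d] by simp

lemma is_afobdd_SSA_afobdd: "is_afobdd n (SSA_afobdd d n)"
proof -
  let ?M = "SSA_afobdd d n"
  have trans: "affine_mat (num_affine ?M) (atrans ?M j s b)" for j s b
    by (simp add: SSA_afobdd_def affine_mat_one affine_mat_mult affine_mat_storage_mat
        select_mat_def affine_mat_complete_mat)
  have delta: "cdelta ?M j s b \<in> cstates ?M" if "s \<in> cstates ?M" for j s b
    using that by (auto simp: SSA_afobdd_def update_address_def)
  have "ainit ?M \<in> carrier_vec (num_affine ?M)"
    by (simp add: SSA_afobdd_def bits_vec_carrier)
  moreover have "(\<Sum>i<num_affine ?M. ainit ?M $ i) = 1"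
    using sum_bits_vec[of "replicate (2 ^ d) False"]
    by (simp add: SSA_afobdd_def del: sum.lessThan_Suc)
  moreover have "finite (cstates ?M)" "cinit ?M \<in> cstates ?M" "cacc ?M \<subseteq> cstates ?M"
      "aacc ?M \<subseteq> {..<num_affine ?M}" "var_order ?M permutes {1..n}"
    by (simp_all add: SSA_afobdd_def finite_bool_lists permutes_id)
  ultimately show ?thesis
    unfolding is_afobdd_def using trans delta by (auto simp: affine_mat_def)
qed

section \<open>Runs of the automaton\<close>

lemma storage_mat_mult_SSA_storage:
  "storage_mat (2 ^ d) (x (Suc (2 * i))) (x (Suc (Suc (2 * i)))) *\<^sub>v bits_vec (SSA_storage d (2 * i) x) =
     bits_vec (SSA_storage d (2 * Suc i) x)"
proof (cases "x (Suc (2 * i))")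
  case True
  have "bits_vec (SSA_storage d (2 * i) x) \<in> carrier_vec (Suc (2 ^ d))"
    by (intro bits_vec_carrier length_SSA_storage)
  with True show ?thesis
    unfolding SSA_storage_Suc storage_mat_def by simp
next
  case False
  then show ?thesis
    unfolding SSA_storage_Suc storage_mat_def
    by (simp add: shift_mat_mult length_SSA_storage)
qed

lemma update_address_SSA:
  "update_address (SSA_address d (2 * i) x, x (Suc (2 * i))) (x (Suc (Suc (2 * i)))) =
     SSA_address d (2 * Suc i) x"
  unfolding SSA_address_Suc update_address_def by simp

text \<open>Stated as an implication to serve both the induction over pairs and the last pair, whose
  even step differs.\<close>

lemma config_SSA_afobdd_odd:
  assumes "config (SSA_afobdd d n) x (2 * i) =
      ((SSA_address d (2 * i) x, False), bits_vec (SSA_storage d (2 * i) x))"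
  shows "config (SSA_afobdd d n) x (Suc (2 * i)) =
      ((SSA_address d (2 * i) x, x (Suc (2 * i))), bits_vec (SSA_storage d (2 * i) x))"
proof -
  have "bits_vec (SSA_storage d (2 * i) x) \<in> carrier_vec (Suc (2 ^ d))"
    by (intro bits_vec_carrier length_SSA_storage)
  then show ?thesis
    unfolding config.simps assms by (simp add: SSA_afobdd_def)
qed

text \<open>The strict bound excludes the last even step, whose matrix also selects.\<close>

lemma config_SSA_afobdd_even:
  assumes "2 * i < n"
  shows "config (SSA_afobdd d n) x (2 * i) =
      ((SSA_address d (2 * i) x, False), bits_vec (SSA_storage d (2 * i) x))"
  using assms
proof (induction i)
  case 0
  show ?case by (simp add: SSA_afobdd_def SSA_storage_0 SSA_address_0)
next
  case (Suc i)
  have step: "config (SSA_afobdd d n) x (Suc (2 * i)) =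
      ((SSA_address d (2 * i) x, x (Suc (2 * i))), bits_vec (SSA_storage d (2 * i) x))"
    using Suc by (intro config_SSA_afobdd_odd) simp
  have idx: "2 * Suc i = Suc (Suc (2 * i))" by simp
  have ne: "Suc (Suc (2 * i)) \<noteq> n" using Suc.prems by simp
  have "config (SSA_afobdd d n) x (Suc (Suc (2 * i))) =
      ((SSA_address d (2 * Suc i) x, False), bits_vec (SSA_storage d (2 * Suc i) x))"
    unfolding config.simps(2)[of _ _ "Suc (2 * i)"] step
    unfolding update_address_SSA[symmetric] storage_mat_mult_SSA_storage[symmetric]
    using ne by (simp add: SSA_afobdd_def Let_def)
  then show ?case unfolding idx .
qed

lemma config_SSA_afobdd_final:
  assumes "even n" "n > 0"
  shows "config (SSA_afobdd d n) x n =
      ((SSA_address d n x, False), bits_vec (SSA d n x # replicate (2 ^ d - 1) False))"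
proof -
  obtain i where n: "n = 2 * Suc i"
    using assms by (metis evenE gr0_implies_Suc nat_0_less_mult_iff)
  have step: "config (SSA_afobdd d n) x (Suc (2 * i)) =
      ((SSA_address d (2 * i) x, x (Suc (2 * i))), bits_vec (SSA_storage d (2 * i) x))"
    using n by (intro config_SSA_afobdd_odd config_SSA_afobdd_even) simp
  have idx: "Suc (Suc (2 * i)) = n" using n by simp
  let ?v = "bits_vec (SSA_storage d (2 * i) x)"
  let ?U = "storage_mat (2 ^ d) (x (Suc (2 * i))) (x n)"
  let ?k = "address (SSA_address d n x)"
  have "?k < 2 ^ d"
    using address_less[of "SSA_address d n x"] n by (simp only: length_SSA_address)
  then have sel: "select_mat (2 ^ d) ?k *\<^sub>v bits_vec (SSA_storage d n x) =
      bits_vec (SSA d n x # replicate (2 ^ d - 1) False)"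
    using n by (simp only: select_mat_mult length_SSA_storage SSA_def address_def)
  \<comment> \<open>The last storage update acts first and the selection second, with the address
    that already includes the last data bit.\<close>
  have "(select_mat (2 ^ d) ?k * ?U) *\<^sub>v ?v = select_mat (2 ^ d) ?k *\<^sub>v (?U *\<^sub>v ?v)"
  proof (rule assoc_mult_mat_vec)
    show "select_mat (2 ^ d) ?k \<in> carrier_mat (Suc (2 ^ d)) (Suc (2 ^ d))"
      by (simp add: select_mat_def complete_mat_def)
    show "?U \<in> carrier_mat (Suc (2 ^ d)) (Suc (2 ^ d))"
      using affine_mat_storage_mat by (simp add: affine_mat_def)
    show "?v \<in> carrier_vec (Suc (2 ^ d))"
      by (intro bits_vec_carrier length_SSA_storage)
  qed
  also have "?U *\<^sub>v ?v = bits_vec (SSA_storage d n x)"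
    using storage_mat_mult_SSA_storage[of d x i] unfolding idx n[symmetric] .
  finally have vec: "(select_mat (2 ^ d) ?k * ?U) *\<^sub>v ?v =
      bits_vec (SSA d n x # replicate (2 ^ d - 1) False)"
    unfolding sel .
  have addr: "update_address (SSA_address d (2 * i) x, x (Suc (2 * i))) (x n) = SSA_address d n x"
    using update_address_SSA[of d i x] unfolding idx n[symmetric] .
  have "config (SSA_afobdd d n) x (Suc (Suc (2 * i))) =
      ((SSA_address d n x, False), bits_vec (SSA d n x # replicate (2 ^ d - 1) False))"
    unfolding config.simps(2)[of _ _ "Suc (2 * i)"] step
    unfolding idx
    using assms(1) by (simp add: SSA_afobdd_def Let_def addr vec)
  then show ?thesis unfolding idx .
qed

lemma accept_prob_SSA_afobdd:
  assumes "even n" "n > 0"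
  shows "accept_prob n (SSA_afobdd d n) x = of_bool (SSA d n x)"
proof -
  obtain i where n: "n = 2 * i" using assms(1) by blast
  \<comment> \<open>The storage size is positive, so the affine dimension \<open>Suc (2 ^ d)\<close>
    takes the form \<open>Suc (Suc m)\<close> of \<open>sum_abs_selected\<close>.\<close>
  obtain m where m: "(2::nat) ^ d = Suc m"
    using not0_implies_Suc[of "2 ^ d"] by (metis power_not_zero zero_neq_numeral)
  show ?thesis
    unfolding accept_prob_def config_SSA_afobdd_final[OF assms]
    using sum_abs_selected[of "SSA d n x" m] length_SSA_address[of d i x] n
    by (simp add: SSA_afobdd_def m bits_vec_nth del: sum.lessThan_Suc)
qed

theorem theorem8:
  fixes d n :: nat
  assumes "d \<ge> 1" and "even n" and "2 ^ d + d = n div 2"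
  shows "\<exists>M :: nat afobdd.
           is_afobdd n M \<and>
           card (cstates M) = 2 ^ (d + 1) \<and>
           num_affine M = 2 ^ d + 1 \<and>
           computes_exactly n M (SSA d n)"
proof -
  let ?M = "SSA_afobdd d n"
  \<comment> \<open>For \<open>n = 0\<close> the assumption would give
    \<open>2 ^ d + d = 0\<close>.\<close>
  have "n > 0" using assms by (cases n) auto
  have "finite (cstates ?M)"
    using is_afobdd_SSA_afobdd[of n d] by (simp add: is_afobdd_def)
  then obtain h where "bij_betw h {0..<card (cstates ?M)} (cstates ?M)"
    using ex_bij_betw_nat_finite by blast
  from afobdd_relabel[OF is_afobdd_SSA_afobdd this]
  obtain M :: "nat afobdd" where M: "is_afobdd n M" "cstates M = {0..<card (cstates ?M)}"
    "num_affine M = num_affine ?M" "accept_prob n M = accept_prob n ?M"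
    by blast
  have "card (cstates M) = 2 ^ (d + 1)"
    using M(2) by (simp add: SSA_afobdd_def card_cartesian_product card_bool_lists)
  moreover have "num_affine M = 2 ^ d + 1"
    using M(3) by (simp add: SSA_afobdd_def)
  moreover have "computes_exactly n M (SSA d n)"
    using M(4) accept_prob_SSA_afobdd[OF assms(2) \<open>n > 0\<close>] by (simp add: computes_exactly_def)
  ultimately show ?thesis using M(1) by blast
qed

end
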